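(* Let $m\ge0$ be an integer and let the real numbers $c_{2k+1}^{(m)}$, $d_{2k}^{(m)}$ ($0\le k\le m$) be defined by the polynomial identities, valid for all positive integers $x$, $$\binom{x+m}{x-m-1}=\frac{1}{(2m+1)!}\sum_{k=0}^{m} c_{2k+1}^{(m)} x^{2k+1},\qquad \binom{x+m-1}{x-m-1}+\binom{x+m}{x-m}=\frac{1}{(2m)!}\sum_{k=0}^{m} d_{2k}^{(m)} x^{2k}.$$ Then for all $0\le k\le m$, $$c_{2k+1}^{(m)}=\frac{(2m+1)!}{(2k+1)!}\,\frac{B_{2m-2k}^{(2m+2)}(m+1)}{(2m-2k)!},\qquad d_{2k}^{(m)}=\frac{2\,(2m)!}{(2k)!\,(2m-2k)!}\,B_{2m-2k}^{(2m+1)}(m).$$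
   Context: Convention: $\binom{a}{b}=0$ if $b<0$. For an integer $r\ge 0$ and real $t$, the generalized Bernoulli polynomials $B_n^{(r)}(t)$ are defined by $\frac{x^r}{(e^x-1)^r}e^{tx}=\sum_{n=0}^\infty \frac{B_n^{(r)}(t)}{n!}x^n$ for $|x|<2\pi$. *)

theory Defs
  imports "HOL-Complex_Analysis.Complex_Analysis"
begin

text \<open>
  The binomial coefficient with integer arguments; it vanishes when the lower argument is
  negative. (On \<^typ>\<open>nat\<close>, truncated subtraction would instead produce lower argument 0.)
\<close>

definition binom :: "int \<Rightarrow> int \<Rightarrow> real" where
  "binom a b = (if b < 0 then 0 else real_of_int a gchoose nat b)"

text \<open>
  The generalized Bernoulli polynomials are given by their exponential generating function,
  read as a formal power series; lemma \<open>gen_bernoulli_sums\<close> below shows that this series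
  converges to the generating function for all real x with 0 < |x| < 2 pi.
\<close>

definition gen_bernoulli_fps :: "nat \<Rightarrow> real \<Rightarrow> real fps" where
  "gen_bernoulli_fps r t = fps_X ^ r / (fps_exp 1 - 1) ^ r * fps_exp t"

definition gen_bernoulli :: "nat \<Rightarrow> nat \<Rightarrow> real \<Rightarrow> real" where
  "gen_bernoulli r n t = fact n * fps_nth (gen_bernoulli_fps r t) n"

text \<open>The series of (exp x - 1) / x, used to establish the convergence.\<close>

definition expm1_fps :: "'a :: {real_normed_field, banach} fps" where
  "expm1_fps = fps_shift 1 (fps_exp 1 - 1)"

lemma expm1_fps_nth: "fps_nth expm1_fps n = inverse (fact (Suc n) :: 'a :: {real_normed_field, banach})"
  by (simp add: expm1_fps_def field_simps)

lemma expm1_fps_X: "fps_exp 1 - 1 = fps_X * (expm1_fps :: 'a :: {real_normed_field, banach} fps)"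
proof (rule fps_ext)
  fix n show "fps_nth (fps_exp 1 - 1 :: 'a fps) n = fps_nth (fps_X * expm1_fps) n"
    by (cases n) (simp_all add: expm1_fps_nth field_simps)
qed

lemma expm1_fps_conv_radius: "fps_conv_radius (expm1_fps :: 'a :: {real_normed_field, banach} fps) = \<infinity>"
  using fps_conv_radius_diff[of "fps_exp (1::'a)" 1] by (simp add: expm1_fps_def)

lemma eval_expm1_fps:
  "eval_fps (expm1_fps :: 'a :: {real_normed_field, banach} fps) z = (if z = 0 then 1 else (exp z - 1) / z)"
proof (cases "z = 0")
  case False
  have "eval_fps (fps_exp 1 - 1) z = z * eval_fps (expm1_fps :: 'a fps) z"
    unfolding expm1_fps_X by (subst eval_fps_mult) (auto simp: expm1_fps_conv_radius)
  moreover have "eval_fps (fps_exp 1 - 1) z = exp z - 1"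
    by (subst eval_fps_diff) auto
  ultimately show ?thesis using False by (simp add: field_simps)
qed (simp add: eval_fps_at_0 expm1_fps_nth)

lemma complex_exp_ne_1:
  assumes "norm (z::complex) < 2 * pi" "z \<noteq> 0" shows "exp z \<noteq> 1"
proof
  assume "exp z = 1"
  then obtain n :: int where n: "Re z = 0" "Im z = of_int (2 * n) * pi"
    by (auto simp: exp_eq_1)
  with assms have "n \<noteq> 0" by (auto simp: complex_eq_iff)
  hence "2 * pi \<le> \<bar>Im z\<bar>" using n by (simp add: abs_mult)
  also have "\<dots> \<le> norm z" by (rule abs_Im_le_cmod)
  finally show False using assms by simp
qed

lemma conv_radius_inverse_expm1_complex:
  "fps_conv_radius (inverse expm1_fps :: complex fps) \<ge> ereal (2 * pi)"
proof -
  define f :: "complex \<Rightarrow> complex" where "f = (\<lambda>z. inverse (eval_fps expm1_fps z))"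
  define G where "G = Abs_fps (\<lambda>n. (deriv ^^ n) f 0 / fact n)"
  have nz: "eval_fps expm1_fps z \<noteq> 0" if "norm (z::complex) < 2 * pi" for z
    using complex_exp_ne_1[of z] that by (auto simp: eval_expm1_fps)
  have "f holomorphic_on ball 0 (2 * pi)"
    unfolding f_def by (intro holomorphic_intros) (auto simp: expm1_fps_conv_radius nz)
  hence sums: "(\<lambda>n. fps_nth G n * z ^ n) sums f z" if "norm z < 2 * pi" for z
    using holomorphic_power_series[of f 0 "2 * pi" z] that by (simp add: G_def)
  have rad: "fps_conv_radius G \<ge> ereal (2 * pi)"
    unfolding fps_conv_radius_def
  proof (rule conv_radius_geI_ex)
    fix r :: real assume "0 < r" "ereal r < ereal (2 * pi)"
    thus "\<exists>z. norm z = r \<and> summable (\<lambda>n. fps_nth G n * z ^ n)"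
      using sums[of "of_real r"] by (intro exI[of _ "of_real r"]) (auto simp: sums_iff)
  qed
  have "ereal 0 < ereal (2 * pi)" by simp
  also note rad
  finally have rad0: "fps_conv_radius G > 0" by (simp add: zero_ereal_def)
  have "G * expm1_fps = 1"
  proof (rule eval_fps_eqD)
    show "fps_conv_radius (G * expm1_fps) > 0"
      using fps_conv_radius_mult[of G expm1_fps] rad0 by (simp add: expm1_fps_conv_radius)
    have "eventually (\<lambda>z::complex. z \<in> ball 0 (2 * pi)) (nhds 0)"
      by (intro eventually_nhds_in_open) auto
    thus "eventually (\<lambda>z. eval_fps (G * expm1_fps) z = eval_fps 1 z) (nhds 0)"
    proof eventually_elim
      case (elim z)
      hence z: "norm z < 2 * pi" by simp
      have "ereal (norm z) < fps_conv_radius G"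
        using z rad by (meson ereal_less_eq(3) less_ereal.simps(1) less_le_trans)
      moreover have "eval_fps G z = f z" using sums[OF z] by (simp add: eval_fps_def sums_iff)
      ultimately show ?case
        using nz[OF z] by (subst eval_fps_mult) (auto simp: expm1_fps_conv_radius f_def)
    qed
  qed simp
  hence "inverse expm1_fps = G"
    using fps_inverse_unique[of expm1_fps G] by (simp add: mult.commute)
  with rad show ?thesis by simp
qed

lemma conv_radius_inverse_expm1:
  "fps_conv_radius (inverse expm1_fps :: real fps) \<ge> ereal (2 * pi)"
proof -
  define I where "I = (inverse expm1_fps :: real fps)"
  define J where "J = Abs_fps (\<lambda>n. complex_of_real (fps_nth I n))"
  have I: "I * expm1_fps = 1" unfolding I_def
    by (rule inverse_mult_eq_1) (simp add: expm1_fps_nth)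
  have "J * expm1_fps = 1"
  proof (rule fps_ext)
    fix n
    have "fps_nth (J * expm1_fps) n = complex_of_real (fps_nth (I * expm1_fps) n)"
      by (simp add: fps_mult_nth J_def expm1_fps_nth)
    thus "fps_nth (J * expm1_fps) n = fps_nth 1 n" by (simp add: I)
  qed
  hence "inverse expm1_fps = J"
    using fps_inverse_unique[of expm1_fps J] by (simp add: mult.commute)
  hence "ereal (2 * pi) \<le> fps_conv_radius J"
    using conv_radius_inverse_expm1_complex by simp
  also have "fps_conv_radius J = fps_conv_radius (Abs_fps (\<lambda>n. norm (fps_nth J n)))" by simp
  also have "\<dots> = fps_conv_radius (Abs_fps (\<lambda>n. norm (fps_nth I n)))" by (simp add: J_def)
  also have "\<dots> = fps_conv_radius I" by (rule fps_conv_radius_norm)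
  finally show ?thesis by (simp add: I_def)
qed

lemma gen_bernoulli_fps_altdef: "gen_bernoulli_fps r t = inverse expm1_fps ^ r * fps_exp t"
proof -
  have nz: "fps_nth (expm1_fps :: real fps) 0 \<noteq> 0" by (simp add: expm1_fps_nth)
  have "inverse expm1_fps * (fps_exp 1 - 1 :: real fps) = (inverse expm1_fps * expm1_fps) * fps_X"
    by (simp only: expm1_fps_X mult_ac)
  hence "inverse expm1_fps * (fps_exp 1 - 1 :: real fps) = fps_X"
    by (simp add: inverse_mult_eq_1[OF nz])
  hence "fps_X ^ r = inverse expm1_fps ^ r * (fps_exp 1 - 1 :: real fps) ^ r"
    by (metis power_mult_distrib)
  moreover have "(fps_exp 1 - 1 :: real fps) \<noteq> 0"
    using nz by (auto simp: expm1_fps_X)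
  ultimately show ?thesis by (simp add: gen_bernoulli_fps_def)
qed

lemma gen_bernoulli_sums:
  assumes "0 < \<bar>x\<bar>" "\<bar>x\<bar> < 2 * pi"
  shows "(\<lambda>n. gen_bernoulli r n t / fact n * x ^ n) sums (x ^ r / (exp x - 1) ^ r * exp (t * x))"
proof -
  define I where "I = (inverse expm1_fps :: real fps)"
  have I: "I * expm1_fps = 1" unfolding I_def
    by (rule inverse_mult_eq_1) (simp add: expm1_fps_nth)
  have radI: "ereal (norm x) < fps_conv_radius I"
    using assms conv_radius_inverse_expm1 less_le_trans[of "ereal (norm x)" "ereal (2 * pi)"]
    by (simp add: I_def)
  hence radP: "ereal (norm x) < fps_conv_radius (I ^ r)"
    using fps_conv_radius_power[of I r] by (rule less_le_trans)
  hence rad: "ereal (norm x) < fps_conv_radius (I ^ r * fps_exp t)"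
    using fps_conv_radius_mult[of "I ^ r" "fps_exp t"]
    by (metis fps_conv_radius_exp inf_top.right_neutral less_le_trans min_def top_ereal_def top_greatest)
  have "eval_fps I x * eval_fps expm1_fps x = 1"
    using radI by (subst eval_fps_mult [symmetric]) (auto simp: I expm1_fps_conv_radius)
  hence "eval_fps I x = x / (exp x - 1)"
    using assms by (simp add: eval_expm1_fps field_simps)
  hence "eval_fps (I ^ r * fps_exp t) x = x ^ r / (exp x - 1) ^ r * exp (t * x)"
    using radI radP by (simp add: eval_fps_mult eval_fps_power power_divide)
  with sums_eval_fps[OF rad] show ?thesis
    by (simp add: gen_bernoulli_def gen_bernoulli_fps_altdef I_def)
qed

end

theory Submission
  imports Defs
begin

text \<open>
  Every binomial coefficient is a value of a generalized Bernoulli polynomial: for all natural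
  numbers $N$ and $n$,
  \[ \binom{N}{n} = \frac{B_n^{(n+1)}(N+1)}{n!}. \]
  Both sides satisfy Pascal's rule in $N$. On the right-hand side this is the identity
  $I e^z - I = z$ with $I = z / (e^z - 1)$, which lowers the order and the degree together. The
  initial values at $N = 0$ also agree: the coefficient of $z^n$ in $I^{n+1} e^z$ is the residue
  at 0 of $e^z / (e^z - 1)^{n+1}$, and for $n > 0$ that function is the derivative of
  $-\frac{1}{n} (e^z - 1)^{-n}$, so its residue vanishes (lemma
  \<open>coeff_inverse_expm1_power_exp\<close>).

  Taking $N = x + m$ and splitting off the factor $e^{xz}$ of the generating function turns the
  value into a polynomial in $x$ whose coefficients are, up to factorials, Bernoulli values at $m + 1$ (lemma
  \<open>binomial_conv_gen_bernoulli\<close>). A polynomial is determined by its values at the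
  positive integers, which yields the formula for $c$. For $d$ the same argument gives
  the sum of the Bernoulli values of order $2m+1$ at $m$ and $m+1$. These two points are
  exchanged by the reflection $t \mapsto 2m + 1 - t$, so for even degree the two terms are equal;
  this is the source of the factor 2.
\<close>

lemma inverse_expm1_fps_mult: "inverse expm1_fps * expm1_fps = (1 :: real fps)"
  by (rule inverse_mult_eq_1) (simp add: expm1_fps_nth)

lemma fps_exp_conv_expm1: "fps_exp 1 = 1 + fps_X * (expm1_fps :: real fps)"
  by (simp flip: expm1_fps_X)

text \<open>
  With $I$ the series of $z/(e^z-1)$, the residue of a derivative vanishes in the following form:
  $n I^{n+1} e^z = n I^n - z (I^n)'$, and the Euler operator $z \frac{d}{dz}$ multiplies the
  coefficient of $z^n$ by $n$.
\<close>

lemma coeff_inverse_expm1_power_exp: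
  "fps_nth (inverse expm1_fps ^ Suc n * fps_exp 1 :: real fps) n = (if n = 0 then 1 else 0)"
proof (cases n)
  case 0
  then show ?thesis by (simp add: expm1_fps_nth)
next
  case (Suc k)
  define E where "E = (expm1_fps :: real fps)"
  define I where "I = inverse E"
  have IE: "I * E = 1"
    unfolding I_def E_def by (rule inverse_expm1_fps_mult)
  have "fps_deriv (fps_exp (1::real)) = fps_deriv (1 + fps_X * E)"
    by (simp only: fps_exp_conv_expm1 E_def)
  hence exp_eq: "fps_exp 1 = E + fps_X * fps_deriv E"
    by simp
  have dI: "fps_deriv I = - fps_deriv E * I ^ 2"
    unfolding I_def by (rule fps_inverse_deriv) (simp add: E_def expm1_fps_nth)
  have "fps_deriv (I ^ n) = of_nat n * fps_deriv I * I ^ k"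
    by (simp only: fps_deriv_power Suc diff_Suc_1 fps_of_nat)
  hence dIn: "fps_deriv (I ^ n) = - (of_nat n * I ^ Suc n * fps_deriv E)"
    by (simp add: dI Suc power2_eq_square algebra_simps)
  have "of_nat n * (I ^ Suc n * fps_exp 1)
      = of_nat n * I ^ n * (I * E) + fps_X * (of_nat n * I ^ Suc n * fps_deriv E)"
    unfolding exp_eq by (simp add: algebra_simps)
  also have "\<dots> = of_nat n * I ^ n - fps_X * fps_deriv (I ^ n)"
    by (simp add: IE dIn)
  finally have "fps_nth (of_nat n * (I ^ Suc n * fps_exp 1)) n
      = fps_nth (of_nat n * I ^ n - fps_X * fps_deriv (I ^ n)) n"
    by simp
  hence "real n * fps_nth (I ^ Suc n * fps_exp 1) n = 0"
    by (simp add: fps_mult_of_nat_nth Suc del: power_Suc of_nat_Suc)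
  thus ?thesis
    by (simp add: Suc I_def E_def del: power_Suc)
qed

lemma gen_bernoulli_fps_add: "gen_bernoulli_fps r (s + t) = gen_bernoulli_fps r s * fps_exp t"
  by (simp add: gen_bernoulli_fps_altdef fps_exp_add_mult mult.assoc)

text \<open>The factor $e^z - 1$ produced by the difference cancels one of the denominators.\<close>

lemma gen_bernoulli_fps_Suc_plus_1:
  "gen_bernoulli_fps (Suc r) (t + 1) = gen_bernoulli_fps (Suc r) t + fps_X * gen_bernoulli_fps r t"
proof -
  have "gen_bernoulli_fps (Suc r) (t + 1)
      = gen_bernoulli_fps (Suc r) t * (1 + fps_X * expm1_fps)"
    by (simp add: gen_bernoulli_fps_add fps_exp_conv_expm1)
  also have "\<dots> = gen_bernoulli_fps (Suc r) t
      + fps_X * (inverse expm1_fps * expm1_fps) * gen_bernoulli_fps r t"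
    by (simp add: gen_bernoulli_fps_altdef algebra_simps)
  finally show ?thesis by (simp add: inverse_expm1_fps_mult)
qed

lemma coeff_gen_bernoulli_fps_Suc_nat:
  "fps_nth (gen_bernoulli_fps (Suc n) (real N + 1)) n = real (N choose n)"
proof (induction N arbitrary: n)
  case 0
  have "fps_nth (gen_bernoulli_fps (Suc n) 1) n = (if n = 0 then 1 else 0)"
    unfolding gen_bernoulli_fps_altdef by (rule coeff_inverse_expm1_power_exp)
  then show ?case by simp
next
  case (Suc N)
  have step: "fps_nth (gen_bernoulli_fps (Suc n) (real (Suc N) + 1)) n
      = fps_nth (gen_bernoulli_fps (Suc n) (real N + 1)) n
        + fps_nth (fps_X * gen_bernoulli_fps n (real N + 1)) n"
    using gen_bernoulli_fps_Suc_plus_1[of n "real N + 1"] by (simp add: add_ac)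
  show ?case
  proof (cases n)
    case 0
    then show ?thesis unfolding step using Suc.IH[of 0] by simp
  next
    case (Suc k)
    then show ?thesis unfolding step using Suc.IH[of n] Suc.IH[of k] by simp
  qed
qed

text \<open>
  The centre $s$ of the expansion is a parameter because the binomial coefficients with upper
  entries $x+m$ and $x+m-1$, both as polynomials in $x$, require the centres $m+1$ and $m$.
\<close>

lemma binomial_conv_gen_bernoulli:
  assumes "real N + 1 = s + y"
  shows "real (N choose n)
    = (\<Sum>j\<le>n. gen_bernoulli (Suc n) (n - j) s / (fact j * fact (n - j)) * y ^ j)"
proof -
  have "real (N choose n) = fps_nth (gen_bernoulli_fps (Suc n) (s + y)) n"
    using coeff_gen_bernoulli_fps_Suc_nat[of n N] assms by simp
  also have "\<dots> = fps_nth (fps_exp y * gen_bernoulli_fps (Suc n) s) n"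
    by (simp add: gen_bernoulli_fps_add mult.commute)
  also have "\<dots> = (\<Sum>j\<le>n. gen_bernoulli (Suc n) (n - j) s / (fact j * fact (n - j)) * y ^ j)"
    unfolding fps_mult_nth atLeast0AtMost by (intro sum.cong) (auto simp: gen_bernoulli_def)
  finally show ?thesis .
qed

text \<open>
  Replacing $z$ by $-z$ in $z/(e^z-1)$ multiplies it by $e^z$, so the $r$-th power contributes a
  factor $e^{rz}$, which turns $e^{-tz}$ into $e^{(r-t)z}$.
\<close>

lemma gen_bernoulli_reflect: "gen_bernoulli r n (real r - t) = (-1) ^ n * gen_bernoulli r n t"
proof -
  define E where "E = (expm1_fps :: real fps)"
  define E' where "E' = E oo (- fps_X)"
  define I where "I = inverse E"
  have E0: "fps_nth E 0 \<noteq> 0"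
    by (simp add: E_def expm1_fps_nth)
  have IE: "I * E = 1"
    unfolding I_def E_def by (rule inverse_expm1_fps_mult)
  have "fps_exp (1::real) oo (- fps_X) = (1 + fps_X * E) oo (- fps_X)"
    by (simp only: fps_exp_conv_expm1 E_def)
  hence "fps_exp (-1::real) = 1 - fps_X * E'"
    by (simp add: fps_compose_add_distrib fps_compose_mult_distrib E'_def
        fps_exp_compose_linear[of 1 "-1", simplified])
  hence "fps_X * E' = 1 - fps_exp (-1)"
    by simp
  hence "fps_X * E' * fps_exp 1 = fps_exp 1 - fps_exp (-1) * fps_exp 1"
    by (simp add: left_diff_distrib)
  also have "\<dots> = fps_X * E"
  proof -
    have "fps_exp (-1) * fps_exp 1 = (1 :: real fps)"
      by (simp flip: fps_exp_add_mult)
    thus ?thesis by (simp add: fps_exp_conv_expm1 E_def)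
  qed
  finally have "E' * fps_exp 1 = E"
    by (simp add: mult.assoc)
  hence "E' * (I * fps_exp 1) = 1"
    using IE by (metis mult.assoc mult.commute)
  hence "inverse E' = I * fps_exp 1"
    by (rule fps_inverse_unique)
  hence I_refl: "I oo (- fps_X) = I * fps_exp 1"
    by (simp add: I_def E'_def fps_inverse_compose E0)
  have "gen_bernoulli_fps r t oo (- fps_X) = (I oo (- fps_X)) ^ r * fps_exp (- t)"
    by (simp add: gen_bernoulli_fps_altdef fps_compose_mult_distrib fps_compose_power
        I_def E_def fps_exp_compose_linear[of t "-1", simplified])
  also have "\<dots> = I ^ r * (fps_exp (real r) * fps_exp (- t))"
    by (simp add: I_refl power_mult_distrib fps_exp_power_mult mult.assoc)
  also have "\<dots> = gen_bernoulli_fps r (real r - t)"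
    by (simp add: gen_bernoulli_fps_altdef I_def E_def flip: fps_exp_add_mult)
  finally have "fps_nth (gen_bernoulli_fps r (real r - t)) n
      = fps_nth (gen_bernoulli_fps r t oo (- fps_X)) n"
    by simp
  thus ?thesis
    by (simp add: gen_bernoulli_def fps_compose_uminus')
qed

text \<open>
  For $k > N$ both sides vanish. This range matters: the hypotheses of the theorem also cover the
  integers $1 \<le> x \<le> m$.
\<close>

lemma binom_complement: "binom (int N) (int N - int k) = real (N choose k)"
proof (cases "k \<le> N")
  case True
  hence "nat (int N - int k) = N - k" by simp
  with True show ?thesis
    by (simp add: binom_def binomial_symmetric[of k N] flip: binomial_gbinomial)
qed (simp add: binom_def)

lemma coeff_eq_if_poly_eq_on_pos_nats:
  fixes p :: "real poly"
  assumes eq: "\<And>x::nat. x > 0 \<Longrightarrow> poly p (real x) = (\<Sum>j\<le>n. a j * real x ^ j)"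
    and "i \<le> n"
  shows "coeff p i = a i"
proof -
  define q where "q = (\<Sum>j\<le>n. monom (a j) j)"
  have "real ` {0<..} \<subseteq> {x. poly (p - q) x = 0}"
    by (auto simp: eq q_def poly_sum poly_monom)
  moreover have "infinite (real ` {0<..})"
    by (simp add: finite_image_iff infinite_Ioi)
  ultimately have "infinite {x. poly (p - q) x = 0}"
    using finite_subset by blast
  hence "p = q"
    using poly_roots_finite[of "p - q"] by auto
  thus ?thesis
    using \<open>i \<le> n\<close> by (simp add: q_def coeff_sum)
qed

theorem proposition3p3:
  fixes m :: nat and c d :: "nat \<Rightarrow> real"
  assumes c: "\<And>x::nat. x > 0 \<Longrightarrow>
      binom (int x + int m) (int x - int m - 1)
        = 1 / fact (2 * m + 1) * (\<Sum>k=0..m. c (2 * k + 1) * real x ^ (2 * k + 1))"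
    and d: "\<And>x::nat. x > 0 \<Longrightarrow>
      binom (int x + int m - 1) (int x - int m - 1) + binom (int x + int m) (int x - int m)
        = 1 / fact (2 * m) * (\<Sum>k=0..m. d (2 * k) * real x ^ (2 * k))"
  shows "\<forall>k\<le>m.
      c (2 * k + 1) = fact (2 * m + 1) / fact (2 * k + 1)
        * (gen_bernoulli (2 * m + 2) (2 * m - 2 * k) (real m + 1) / fact (2 * m - 2 * k))
    \<and> d (2 * k) = 2 * fact (2 * m) / (fact (2 * k) * fact (2 * m - 2 * k))
        * gen_bernoulli (2 * m + 1) (2 * m - 2 * k) (real m)"
proof (intro allI impI conjI)
  fix k assume k: "k \<le> m"
  define p where "p = (\<Sum>i=0..m. monom (c (2 * i + 1) / fact (2 * m + 1)) (2 * i + 1))"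
  have "poly p (real x) = (\<Sum>j\<le>2 * m + 1. gen_bernoulli (2 * m + 2) (2 * m + 1 - j) (real m + 1)
      / (fact j * fact (2 * m + 1 - j)) * real x ^ j)" if "x > 0" for x :: nat
  proof -
    have "poly p (real x) = binom (int x + int m) (int x - int m - 1)"
      unfolding c[OF that] by (simp add: p_def poly_sum poly_monom sum_divide_distrib)
    also have "\<dots> = real ((x + m) choose (2 * m + 1))"
      using binom_complement[of "x + m" "2 * m + 1"] by (simp add: algebra_simps)
    finally show ?thesis
      using binomial_conv_gen_bernoulli[of "x + m" "real m + 1" "real x" "2 * m + 1"] by simp
  qed
  hence "coeff p (2 * k + 1) = gen_bernoulli (2 * m + 2) (2 * m + 1 - (2 * k + 1)) (real m + 1)
      / (fact (2 * k + 1) * fact (2 * m + 1 - (2 * k + 1)))"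
    by (rule coeff_eq_if_poly_eq_on_pos_nats) (use k in auto)
  moreover have "c (2 * k + 1) = fact (2 * m + 1) * coeff p (2 * k + 1)"
    using k by (simp add: p_def coeff_sum)
  ultimately show "c (2 * k + 1) = fact (2 * m + 1) / fact (2 * k + 1)
      * (gen_bernoulli (2 * m + 2) (2 * m - 2 * k) (real m + 1) / fact (2 * m - 2 * k))"
    by simp
next
  fix k assume k: "k \<le> m"
  define p where "p = (\<Sum>i=0..m. monom (d (2 * i) / fact (2 * m)) (2 * i))"
  define b where "b = (\<lambda>j t. gen_bernoulli (2 * m + 1) (2 * m - j) t / (fact j * fact (2 * m - j)))"
  have "poly p (real x) = (\<Sum>j\<le>2 * m. (b j (real m) + b j (real m + 1)) * real x ^ j)"
    if "x > 0" for x :: nat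
  proof -
    have "poly p (real x) = binom (int x + int m - 1) (int x - int m - 1)
        + binom (int x + int m) (int x - int m)"
      unfolding d[OF that] by (simp add: p_def poly_sum poly_monom sum_divide_distrib)
    also have "binom (int x + int m - 1) (int x - int m - 1) = real ((x + m - 1) choose (2 * m))"
      using binom_complement[of "x + m - 1" "2 * m"] that by (simp add: of_nat_diff algebra_simps)
    also have "binom (int x + int m) (int x - int m) = real ((x + m) choose (2 * m))"
      using binom_complement[of "x + m" "2 * m"] by (simp add: algebra_simps)
    also have "real ((x + m - 1) choose (2 * m)) = (\<Sum>j\<le>2 * m. b j (real m) * real x ^ j)"
      using binomial_conv_gen_bernoulli[of "x + m - 1" "real m" "real x" "2 * m"] that
      by (simp add: b_def of_nat_diff)
    also have "real ((x + m) choose (2 * m)) = (\<Sum>j\<le>2 * m. b j (real m + 1) * real x ^ j)"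
      using binomial_conv_gen_bernoulli[of "x + m" "real m + 1" "real x" "2 * m"]
      by (simp add: b_def)
    finally show ?thesis
      by (simp add: algebra_simps sum.distrib)
  qed
  hence "coeff p (2 * k) = b (2 * k) (real m) + b (2 * k) (real m + 1)"
    by (rule coeff_eq_if_poly_eq_on_pos_nats) (use k in auto)
  moreover have "d (2 * k) = fact (2 * m) * coeff p (2 * k)"
    using k by (simp add: p_def coeff_sum)
  moreover have "b (2 * k) (real m + 1) = b (2 * k) (real m)"
    using gen_bernoulli_reflect[of "2 * m + 1" "2 * m - 2 * k" "real m"] by (simp add: b_def)
  ultimately show "d (2 * k) = 2 * fact (2 * m) / (fact (2 * k) * fact (2 * m - 2 * k))
      * gen_bernoulli (2 * m + 1) (2 * m - 2 * k) (real m)"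
    by (simp add: b_def)
qed

end
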